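(* Let $(A,[\cdot,\cdot],[\![\cdot,\cdot,\cdot]\!],\alpha)$ be a Hom-Lie-Yamaguti algebra, $(V,\rho,\theta,\beta)$ a representation of it, $(\mathcal F,\mathcal G)$ a $(2,3)$-cocycle with coefficients in $(V,\rho,\theta,\beta)$, and $T:V\to A$ an $(\mathcal F,\mathcal G)$-twisted $\mathcal O$-operator. Define, for all $u,v,w\in V$, $$[u,v]_T=\rho(Tu)v-\rho(Tv)u+\mathcal F(Tu,Tv),$$ $$[\![u,v,w]\!]_T=D(Tu,Tv)w+\theta(Tv,Tw)u-\theta(Tu,Tw)v+\mathcal G(Tu,Tv,Tw).$$ Then $(V,[\cdot,\cdot]_T,[\![\cdot,\cdot,\cdot]\!]_T,\beta)$ is a Hom-Lie-Yamaguti algebra. Moreover, $T$ is a morphism of Hom-Lie-Yamaguti algebras from $(V,[\cdot,\cdot]_T,[\![\cdot,\cdot,\cdot]\!]_T,\beta)$ to $(A,[\cdot,\cdot],[\![\cdot,\cdot,\cdot]\!],\alpha)$.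
   Context: All linear spaces are finite-dimensional over a field $\mathbb K$ of characteristic $0$. $\circlearrowleft_{x,y,z}$ denotes the sum over cyclic permutations of $(x,y,z)$. A Hom-Lie-Yamaguti algebra $(A,[\cdot,\cdot],[\![\cdot,\cdot,\cdot]\!],\alpha)$ is a linear space $A$ with a linear map $\alpha:A\to A$, a bilinear bracket and a trilinear bracket such that for all $x,y,z,w,t\in A$: (1) $[x,y]=-[y,x]$ and $[\![x,y,z]\!]=-[\![y,x,z]\!]$; (2) $\circlearrowleft_{x,y,z}[[x,y],\alpha(z)]+\circlearrowleft_{x,y,z}[\![x,y,z]\!]=0$; (3) $\circlearrowleft_{x,y,z}[\![[x,y],\alpha(z),\alpha(w)]\!]=0$; (4) $[\![\alpha(x),\alpha(y),[z,w]]\!]=[[\![x,y,z]\!],\alpha^2(w)]+[\alpha^2(z),[\![x,y,w]\!]]$; (5) $[\![\alpha^2(x),\alpha^2(y),[\![z,w,t]\!]]\!]=[\![[\![x,y,z]\!],\alpha^2(w),\alpha^2(t)]\!]+[\![\alpha^2(z),[\![x,y,w]\!],\alpha^2(t)]\!]+[\![\alpha^2(z),\alpha^2(w),[\![x,y,t]\!]]\!]$. A morphism of Hom-Lie-Yamaguti algebras is a linear map $\phi$ with $\phi([x,y])=[\phi(x),\phi(y)]$ and $\phi([\![x,y,z]\!])=[\![\phi(x),\phi(y),\phi(z)]\!]$. Representation $(V,\rho,\theta,\beta)$ on $(V,\beta)$ ($\beta:V\to V$ linear): a linear map $\rho:A\to \mathfrak{gl}(V)$ and a bilinear map $\theta:A\times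 A\to \mathfrak{gl}(V)$ such that, with $$D(x,y):=\theta(y,x)-\theta(x,y)+\rho(\alpha(x))\rho(y)-\rho(\alpha(y))\rho(x)-\rho([x,y])\beta,$$ for all elements of $A$: (R1) $\rho(\alpha(x_1))\beta=\beta\rho(x_1)$, $\theta(\alpha(x_1),\alpha(x_2))\beta=\beta\theta(x_1,x_2)$; (R2) $D([x_1,x_2],\alpha(x_3))+D([x_2,x_3],\alpha(x_1))+D([x_3,x_1],\alpha(x_2))=0$; (R3) $\theta([x_1,x_2],\alpha(y_1))\beta=\theta(\alpha(x_1),\alpha(y_1))\rho(x_2)-\theta(\alpha(x_2),\alpha(y_1))\rho(x_1)$; (R4) $D(\alpha(x_1),\alpha(x_2))\rho(y_2)=\rho(\alpha^2(y_2))D(x_1,x_2)+\rho([\![x_1,x_2,y_2]\!])\beta^2$; (R5) $\theta(\alpha(x_1),[y_1,y_2])\beta=\rho(\alpha^2(y_1))\theta(x_1,y_2)-\rho(\alpha^2(y_2))\theta(x_1,y_1)$; (R6) $D(\alpha^2(x_1),\alpha^2(x_2))\theta(y_1,y_2)=\theta(\alpha^2(y_1),\alpha^2(y_2))D(x_1,x_2)+\theta([\![x_1,x_2,y_1]\!],\alpha^2(y_2))\beta^2+\theta(\alpha^2(y_1),[\![x_1,x_2,y_2]\!])\beta^2$; (R7) $\theta(\alpha^2(x_1),[\![y_1,y_2,y_3]\!])\beta^2=\theta(\alpha^2(y_2),\alpha^2(y_3))\theta(x_1,y_1)-\theta(\alpha^2(y_1),\alpha^2(y_3))\theta(x_1,y_2)+D(\alpha^2(y_1),\alpha^2(y_2))\theta(x_1,y_3)$.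 A $(2,3)$-cocycle with coefficients in $(V,\rho,\theta,\beta)$: a pair $(\mathcal F,\mathcal G)$ with $\mathcal F:A\times A\to V$ bilinear skew-symmetric, $\mathcal G:A\times A\times A\to V$ trilinear and skew-symmetric in its first two arguments, $\mathcal F(\alpha(x),\alpha(y))=\beta\mathcal F(x,y)$, $\mathcal G(\alpha(x),\alpha(y),\alpha(z))=\beta\mathcal G(x,y,z)$, and (C1) $\circlearrowleft_{x,y,z}\big(\mathcal F([x,y],\alpha(z))-\rho(\alpha(x))\mathcal F(y,z)+\mathcal G(x,y,z)\big)=0$; (C2) $\circlearrowleft_{x,y,z}\big(\theta(\alpha(x),\alpha(t))\mathcal F(y,z)+\mathcal G([x,y],\alpha(z),\alpha(t))\big)=0$; (C3) $D(\alpha(x),\alpha(y))\mathcal F(z,t)+\rho(\alpha^2(t))\mathcal G(x,y,z)-\mathcal F([\![x,y,z]\!],\alpha^2(t))+\mathcal G(\alpha(x),\alpha(y),[z,t])-\rho(\alpha^2(z))\mathcal G(x,y,t)-\mathcal F(\alpha^2(z),[\![x,y,t]\!])=0$; (C4) $-\theta(\alpha^2(x_4),\alpha^2(z))\mathcal G(x_1,x_2,x_3)+\theta(\alpha^2(x_3),\alpha^2(z))\mathcal G(x_1,x_2,x_4)+D(\alpha^2(x_1),\alpha^2(x_2))\mathcal G(x_3,x_4,z)-D(\alpha^2(x_3),\alpha^2(x_4))\mathcal G(x_1,x_2,z)-\mathcal G([\![x_1,x_2,x_3]\!],\alpha^2(x_4),\alpha^2(z))-\mathcal G(\alpha^2(x_3),[\![x_1,x_2,x_4]\!],\alpha^2(z))+\mathcal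 G(\alpha^2(x_1),\alpha^2(x_2),[\![x_3,x_4,z]\!])-\mathcal G(\alpha^2(x_3),\alpha^2(x_4),[\![x_1,x_2,z]\!])=0$. An $(\mathcal F,\mathcal G)$-twisted $\mathcal O$-operator with respect to $(V,\rho,\theta,\beta)$ is a linear map $T:V\to A$ such that for all $u,v,w\in V$: $T\beta=\alpha T$; $[Tu,Tv]=T\big(\rho(Tu)v-\rho(Tv)u+\mathcal F(Tu,Tv)\big)$; $[\![Tu,Tv,Tw]\!]=T\big(D(Tu,Tv)w+\theta(Tv,Tw)u-\theta(Tu,Tw)v+\mathcal G(Tu,Tv,Tw)\big)$. *)

theory Defs
  imports Complex_Main
begin

text \<open>
  A linear space over a field \<open>'k\<close> of characteristic 0 is a type \<open>'a\<close> together with a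
  scalar multiplication. Elements of \<open>gl(V)\<close> are linear functions \<open>'v \<Rightarrow> 'v\<close>, whose vector
  space operations are pointwise, so operator identities are stated at every \<open>v\<close>.
\<close>

definition fin_dim_space :: "('k::field_char_0 \<Rightarrow> 'a::ab_group_add \<Rightarrow> 'a) \<Rightarrow> bool" where
  "fin_dim_space s \<longleftrightarrow> (\<exists>B. finite_dimensional_vector_space s B)"

definition bilinear_map ::
  "('k::field_char_0 \<Rightarrow> 'a::ab_group_add \<Rightarrow> 'a) \<Rightarrow> ('k \<Rightarrow> 'b::ab_group_add \<Rightarrow> 'b) \<Rightarrow>
   ('k \<Rightarrow> 'c::ab_group_add \<Rightarrow> 'c) \<Rightarrow> ('a \<Rightarrow> 'b \<Rightarrow> 'c) \<Rightarrow> bool" where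
  "bilinear_map s1 s2 s3 f \<longleftrightarrow>
     (\<forall>x. Vector_Spaces.linear s2 s3 (\<lambda>y. f x y)) \<and>
     (\<forall>y. Vector_Spaces.linear s1 s3 (\<lambda>x. f x y))"

definition trilinear_map ::
  "('k::field_char_0 \<Rightarrow> 'a::ab_group_add \<Rightarrow> 'a) \<Rightarrow> ('k \<Rightarrow> 'b::ab_group_add \<Rightarrow> 'b) \<Rightarrow>
   ('k \<Rightarrow> 'c::ab_group_add \<Rightarrow> 'c) \<Rightarrow> ('k \<Rightarrow> 'd::ab_group_add \<Rightarrow> 'd) \<Rightarrow>
   ('a \<Rightarrow> 'b \<Rightarrow> 'c \<Rightarrow> 'd) \<Rightarrow> bool" where
  "trilinear_map s1 s2 s3 s4 f \<longleftrightarrow>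
     (\<forall>x y. Vector_Spaces.linear s3 s4 (\<lambda>z. f x y z)) \<and>
     (\<forall>x z. Vector_Spaces.linear s2 s4 (\<lambda>y. f x y z)) \<and>
     (\<forall>y z. Vector_Spaces.linear s1 s4 (\<lambda>x. f x y z))"

definition cyclic_sum :: "('a \<Rightarrow> 'a \<Rightarrow> 'a \<Rightarrow> 'b::ab_group_add) \<Rightarrow> 'a \<Rightarrow> 'a \<Rightarrow> 'a \<Rightarrow> 'b" where
  "cyclic_sum f x y z = f x y z + f y z x + f z x y"

text \<open>The twisting map \<open>\<alpha>\<close> is not required to be multiplicative.\<close>

locale hom_lie_yamaguti_algebra =
  fixes sA :: "'k::field_char_0 \<Rightarrow> 'a::ab_group_add \<Rightarrow> 'a"
    and br :: "'a \<Rightarrow> 'a \<Rightarrow> 'a"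
    and tr :: "'a \<Rightarrow> 'a \<Rightarrow> 'a \<Rightarrow> 'a"
    and \<alpha> :: "'a \<Rightarrow> 'a"
  assumes fin_dim: "fin_dim_space sA"
    and linear_alpha: "Vector_Spaces.linear sA sA \<alpha>"
    and bilinear_br: "bilinear_map sA sA sA br"
    and trilinear_tr: "trilinear_map sA sA sA sA tr"
    and br_skew: "br x y = - br y x"
    and tr_skew: "tr x y z = - tr y x z"
    and hly2: "cyclic_sum (\<lambda>x y z. br (br x y) (\<alpha> z)) x y z + cyclic_sum tr x y z = 0"
    and hly3: "cyclic_sum (\<lambda>x y z. tr (br x y) (\<alpha> z) (\<alpha> w)) x y z = 0"
    and hly4: "tr (\<alpha> x) (\<alpha> y) (br z w) =
      br (tr x y z) (\<alpha> (\<alpha> w)) + br (\<alpha> (\<alpha> z)) (tr x y w)"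
    and hly5: "tr (\<alpha> (\<alpha> x)) (\<alpha> (\<alpha> y)) (tr z w t) =
      tr (tr x y z) (\<alpha> (\<alpha> w)) (\<alpha> (\<alpha> t))
      + tr (\<alpha> (\<alpha> z)) (tr x y w) (\<alpha> (\<alpha> t))
      + tr (\<alpha> (\<alpha> z)) (\<alpha> (\<alpha> w)) (tr x y t)"

locale hly_morphism =
  dom: hom_lie_yamaguti_algebra sA brA trA \<alpha> + cod: hom_lie_yamaguti_algebra sB brB trB \<beta>
  for sA :: "'k::field_char_0 \<Rightarrow> 'a::ab_group_add \<Rightarrow> 'a" and brA trA \<alpha>
    and sB :: "'k \<Rightarrow> 'b::ab_group_add \<Rightarrow> 'b" and brB trB \<beta> +
  fixes \<phi> :: "'a \<Rightarrow> 'b"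
  assumes linear_phi: "Vector_Spaces.linear sA sB \<phi>"
    and phi_br: "\<phi> (brA x y) = brB (\<phi> x) (\<phi> y)"
    and phi_tr: "\<phi> (trA x y z) = trB (\<phi> x) (\<phi> y) (\<phi> z)"

definition rep_D ::
  "('a \<Rightarrow> 'a \<Rightarrow> 'a) \<Rightarrow> ('a \<Rightarrow> 'a) \<Rightarrow> ('a \<Rightarrow> 'v \<Rightarrow> 'v) \<Rightarrow> ('a \<Rightarrow> 'a \<Rightarrow> 'v \<Rightarrow> 'v) \<Rightarrow> ('v \<Rightarrow> 'v) \<Rightarrow>
   'a \<Rightarrow> 'a \<Rightarrow> 'v \<Rightarrow> 'v::ab_group_add" where
  "rep_D br \<alpha> \<rho> \<theta> \<beta> x y v =
     \<theta> y x v - \<theta> x y v + \<rho> (\<alpha> x) (\<rho> y v) - \<rho> (\<alpha> y) (\<rho> x v) - \<rho> (br x y) (\<beta> v)"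

locale hly_representation = hom_lie_yamaguti_algebra sA br tr \<alpha>
  for sA :: "'k::field_char_0 \<Rightarrow> 'a::ab_group_add \<Rightarrow> 'a" and br tr \<alpha> +
  fixes sV :: "'k \<Rightarrow> 'v::ab_group_add \<Rightarrow> 'v"
    and \<rho> :: "'a \<Rightarrow> 'v \<Rightarrow> 'v"
    and \<theta> :: "'a \<Rightarrow> 'a \<Rightarrow> 'v \<Rightarrow> 'v"
    and \<beta> :: "'v \<Rightarrow> 'v"
  assumes fin_dim_V: "fin_dim_space sV"
    and linear_beta: "Vector_Spaces.linear sV sV \<beta>"
    and rho_gl: "Vector_Spaces.linear sV sV (\<rho> x)"
    and rho_linear: "Vector_Spaces.linear sA sV (\<lambda>x. \<rho> x v)"
    and theta_gl: "Vector_Spaces.linear sV sV (\<theta> x y)"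
    and theta_bilinear: "bilinear_map sA sA sV (\<lambda>x y. \<theta> x y v)"
    and R1_rho: "\<rho> (\<alpha> x1) (\<beta> v) = \<beta> (\<rho> x1 v)"
    and R1_theta: "\<theta> (\<alpha> x1) (\<alpha> x2) (\<beta> v) = \<beta> (\<theta> x1 x2 v)"
    and R2: "rep_D br \<alpha> \<rho> \<theta> \<beta> (br x1 x2) (\<alpha> x3) v + rep_D br \<alpha> \<rho> \<theta> \<beta> (br x2 x3) (\<alpha> x1) v
      + rep_D br \<alpha> \<rho> \<theta> \<beta> (br x3 x1) (\<alpha> x2) v = 0"
    and R3: "\<theta> (br x1 x2) (\<alpha> y1) (\<beta> v) =
      \<theta> (\<alpha> x1) (\<alpha> y1) (\<rho> x2 v) - \<theta> (\<alpha> x2) (\<alpha> y1) (\<rho> x1 v)"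
    and R4: "rep_D br \<alpha> \<rho> \<theta> \<beta> (\<alpha> x1) (\<alpha> x2) (\<rho> y2 v) =
      \<rho> (\<alpha> (\<alpha> y2)) (rep_D br \<alpha> \<rho> \<theta> \<beta> x1 x2 v) + \<rho> (tr x1 x2 y2) (\<beta> (\<beta> v))"
    and R5: "\<theta> (\<alpha> x1) (br y1 y2) (\<beta> v) =
      \<rho> (\<alpha> (\<alpha> y1)) (\<theta> x1 y2 v) - \<rho> (\<alpha> (\<alpha> y2)) (\<theta> x1 y1 v)"
    and R6: "rep_D br \<alpha> \<rho> \<theta> \<beta> (\<alpha> (\<alpha> x1)) (\<alpha> (\<alpha> x2)) (\<theta> y1 y2 v) =
      \<theta> (\<alpha> (\<alpha> y1)) (\<alpha> (\<alpha> y2)) (rep_D br \<alpha> \<rho> \<theta> \<beta> x1 x2 v)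
      + \<theta> (tr x1 x2 y1) (\<alpha> (\<alpha> y2)) (\<beta> (\<beta> v))
      + \<theta> (\<alpha> (\<alpha> y1)) (tr x1 x2 y2) (\<beta> (\<beta> v))"
    and R7: "\<theta> (\<alpha> (\<alpha> x1)) (tr y1 y2 y3) (\<beta> (\<beta> v)) =
      \<theta> (\<alpha> (\<alpha> y2)) (\<alpha> (\<alpha> y3)) (\<theta> x1 y1 v)
      - \<theta> (\<alpha> (\<alpha> y1)) (\<alpha> (\<alpha> y3)) (\<theta> x1 y2 v)
      + rep_D br \<alpha> \<rho> \<theta> \<beta> (\<alpha> (\<alpha> y1)) (\<alpha> (\<alpha> y2)) (\<theta> x1 y3 v)"

locale hly_cocycle = hly_representation sA br tr \<alpha> sV \<rho> \<theta> \<beta>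
  for sA :: "'k::field_char_0 \<Rightarrow> 'a::ab_group_add \<Rightarrow> 'a" and br tr \<alpha>
    and sV :: "'k \<Rightarrow> 'v::ab_group_add \<Rightarrow> 'v" and \<rho> \<theta> \<beta> +
  fixes F :: "'a \<Rightarrow> 'a \<Rightarrow> 'v"
    and G :: "'a \<Rightarrow> 'a \<Rightarrow> 'a \<Rightarrow> 'v"
  assumes F_bilinear: "bilinear_map sA sA sV F"
    and F_skew: "F x y = - F y x"
    and G_trilinear: "trilinear_map sA sA sA sV G"
    and G_skew: "G x y z = - G y x z"
    and F_equivariant: "F (\<alpha> x) (\<alpha> y) = \<beta> (F x y)"
    and G_equivariant: "G (\<alpha> x) (\<alpha> y) (\<alpha> z) = \<beta> (G x y z)"
    and C1: "cyclic_sum (\<lambda>x y z. F (br x y) (\<alpha> z) - \<rho> (\<alpha> x) (F y z) + G x y z) x y z = 0"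
    and C2: "cyclic_sum (\<lambda>x y z. \<theta> (\<alpha> x) (\<alpha> t) (F y z) + G (br x y) (\<alpha> z) (\<alpha> t)) x y z = 0"
    and C3: "rep_D br \<alpha> \<rho> \<theta> \<beta> (\<alpha> x) (\<alpha> y) (F z t) + \<rho> (\<alpha> (\<alpha> t)) (G x y z)
      - F (tr x y z) (\<alpha> (\<alpha> t)) + G (\<alpha> x) (\<alpha> y) (br z t)
      - \<rho> (\<alpha> (\<alpha> z)) (G x y t) - F (\<alpha> (\<alpha> z)) (tr x y t) = 0"
    and C4: "- \<theta> (\<alpha> (\<alpha> x4)) (\<alpha> (\<alpha> z)) (G x1 x2 x3) + \<theta> (\<alpha> (\<alpha> x3)) (\<alpha> (\<alpha> z)) (G x1 x2 x4)
      + rep_D br \<alpha> \<rho> \<theta> \<beta> (\<alpha> (\<alpha> x1)) (\<alpha> (\<alpha> x2)) (G x3 x4 z)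
      - rep_D br \<alpha> \<rho> \<theta> \<beta> (\<alpha> (\<alpha> x3)) (\<alpha> (\<alpha> x4)) (G x1 x2 z)
      - G (tr x1 x2 x3) (\<alpha> (\<alpha> x4)) (\<alpha> (\<alpha> z)) - G (\<alpha> (\<alpha> x3)) (tr x1 x2 x4) (\<alpha> (\<alpha> z))
      + G (\<alpha> (\<alpha> x1)) (\<alpha> (\<alpha> x2)) (tr x3 x4 z) - G (\<alpha> (\<alpha> x3)) (\<alpha> (\<alpha> x4)) (tr x1 x2 z) = 0"

locale twisted_O_operator = hly_cocycle sA br tr \<alpha> sV \<rho> \<theta> \<beta> F G
  for sA :: "'k::field_char_0 \<Rightarrow> 'a::ab_group_add \<Rightarrow> 'a" and br tr \<alpha>
    and sV :: "'k \<Rightarrow> 'v::ab_group_add \<Rightarrow> 'v" and \<rho> \<theta> \<beta> F G +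
  fixes T :: "'v \<Rightarrow> 'a"
  assumes T_linear: "Vector_Spaces.linear sV sA T"
    and T_beta: "T (\<beta> u) = \<alpha> (T u)"
    and T_br: "br (T u) (T v) = T (\<rho> (T u) v - \<rho> (T v) u + F (T u) (T v))"
    and T_tr: "tr (T u) (T v) (T w) =
      T (rep_D br \<alpha> \<rho> \<theta> \<beta> (T u) (T v) w + \<theta> (T v) (T w) u - \<theta> (T u) (T w) v
        + G (T u) (T v) (T w))"

definition T_bracket ::
  "('a \<Rightarrow> 'v \<Rightarrow> 'v) \<Rightarrow> ('a \<Rightarrow> 'a \<Rightarrow> 'v) \<Rightarrow> ('v \<Rightarrow> 'a) \<Rightarrow> 'v \<Rightarrow> 'v \<Rightarrow> 'v::ab_group_add" where
  "T_bracket \<rho> F T u v = \<rho> (T u) v - \<rho> (T v) u + F (T u) (T v)"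

definition T_triple ::
  "('a \<Rightarrow> 'a \<Rightarrow> 'a) \<Rightarrow> ('a \<Rightarrow> 'a) \<Rightarrow> ('a \<Rightarrow> 'v \<Rightarrow> 'v) \<Rightarrow> ('a \<Rightarrow> 'a \<Rightarrow> 'v \<Rightarrow> 'v) \<Rightarrow> ('v \<Rightarrow> 'v) \<Rightarrow>
   ('a \<Rightarrow> 'a \<Rightarrow> 'a \<Rightarrow> 'v) \<Rightarrow> ('v \<Rightarrow> 'a) \<Rightarrow> 'v \<Rightarrow> 'v \<Rightarrow> 'v \<Rightarrow> 'v::ab_group_add" where
  "T_triple br \<alpha> \<rho> \<theta> \<beta> G T u v w =
     rep_D br \<alpha> \<rho> \<theta> \<beta> (T u) (T v) w + \<theta> (T v) (T w) u - \<theta> (T u) (T w) v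
     + G (T u) (T v) (T w)"

end

theory Submission
  imports Defs
begin

text \<open>
  The four mixed axioms for the brackets on \<open>V\<close> are verified coefficientwise: after pushing \<open>T\<close>
  through the inner bracket, the terms linear in each argument cancel by the representation
  axioms, and the remaining ones by the cocycle conditions.  The one coefficient not covered
  directly by an axiom is that of the last argument in the fifth identity, which is the derivation
  rule for \<open>D\<close>.  Its proof needs \<open>\<alpha>\<close> to be multiplicative.  That is not assumed, but it holds on
  the image of \<open>T\<close>, because \<open>T\<close> intertwines \<open>\<beta>\<close> with \<open>\<alpha>\<close> and \<open>\<rho>\<close>, \<open>\<theta>\<close>, \<open>F\<close>, \<open>G\<close> are equivariant.
\<close>

lemma linear_map_add: "Vector_Spaces.linear s1 s2 f \<Longrightarrow> f (x + y) = f x + f y"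
  and linear_map_scale: "Vector_Spaces.linear s1 s2 f \<Longrightarrow> f (s1 c x) = s2 c (f x)"
  and linear_map_diff: "Vector_Spaces.linear s1 s2 f \<Longrightarrow> f (x - y) = f x - f y"
  and linear_map_minus: "Vector_Spaces.linear s1 s2 f \<Longrightarrow> f (- x) = - f x"
  by (auto simp: Vector_Spaces.linear_def module_hom.add module_hom.scale module_hom.diff
      module_hom.neg)

context hom_lie_yamaguti_algebra
begin

lemmas alpha_linear_simps =
  linear_map_add[OF linear_alpha] linear_map_scale[OF linear_alpha]

lemmas br_linear_simps =
  linear_map_add[OF bilinear_br[unfolded bilinear_map_def, THEN conjunct1, rule_format]]
  linear_map_add[OF bilinear_br[unfolded bilinear_map_def, THEN conjunct2, rule_format]]
  linear_map_scale[OF bilinear_br[unfolded bilinear_map_def, THEN conjunct1, rule_format]]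
  linear_map_scale[OF bilinear_br[unfolded bilinear_map_def, THEN conjunct2, rule_format]]

end

context hly_representation
begin

abbreviation D where "D \<equiv> rep_D br \<alpha> \<rho> \<theta> \<beta>"

lemma vector_space_V: "vector_space sV"
  using linear_beta by (simp add: Vector_Spaces.linear_iff)

lemmas V_scale_simps =
  vector_space.vector_space_assms(1)[OF vector_space_V]
  module.scale_right_diff_distrib[OF vector_space_V[folded module_iff_vector_space]]

lemmas beta_linear_simps =
  linear_map_add[OF linear_beta] linear_map_diff[OF linear_beta]
  linear_map_scale[OF linear_beta]

lemmas rho_linear_simps =
  linear_map_add[OF rho_gl] linear_map_diff[OF rho_gl] linear_map_scale[OF rho_gl]
  linear_map_add[OF rho_linear] linear_map_scale[OF rho_linear]

lemmas theta_linear_simps =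
  linear_map_add[OF theta_gl] linear_map_diff[OF theta_gl] linear_map_scale[OF theta_gl]
  linear_map_add[OF theta_bilinear[unfolded bilinear_map_def, THEN conjunct1, rule_format]]
  linear_map_add[OF theta_bilinear[unfolded bilinear_map_def, THEN conjunct2, rule_format]]
  linear_map_scale[OF theta_bilinear[unfolded bilinear_map_def, THEN conjunct1, rule_format]]
  linear_map_scale[OF theta_bilinear[unfolded bilinear_map_def, THEN conjunct2, rule_format]]

lemma D_linear_simps:
  "D x y (u + v) = D x y u + D x y v"
  "D x y (u - v) = D x y u - D x y v"
  "D x y (sV c v) = sV c (D x y v)"
  "D (x + x') y v = D x y v + D x' y v"
  "D (sA c x) y v = sV c (D x y v)"
  "D x (y + y') v = D x y v + D x y' v"
  "D x (sA c y) v = sV c (D x y v)"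
  unfolding rep_D_def
  by (simp_all add: alpha_linear_simps br_linear_simps beta_linear_simps rho_linear_simps
      theta_linear_simps V_scale_simps)

lemma D_skew: "D x y v = - D y x v"
  using linear_map_minus[OF rho_linear, of "br y x" "\<beta> v"] br_skew[of x y]
  by (simp add: rep_D_def)

text \<open>Expand \<open>D z s\<close> and move the outer operator past each summand:
  \<open>R6\<close> handles the \<theta> terms, \<open>R4\<close> the \<rho> terms. The assumptions
  supply the exchanges of \<alpha> with the brackets and of \<beta> with \<open>D\<close> that the
  \<rho> terms call for.\<close>

lemma D_derivation:
  assumes alpha_br: "\<alpha> (\<alpha> (br z s)) = br (\<alpha> (\<alpha> z)) (\<alpha> (\<alpha> s))"
    and alpha_tr: "\<alpha> (tr x y z) = tr (\<alpha> x) (\<alpha> y) (\<alpha> z)" "\<alpha> (tr x y s) = tr (\<alpha> x) (\<alpha> y) (\<alpha> s)"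
    and D_beta: "D (\<alpha> x) (\<alpha> y) (\<beta> v) = \<beta> (D x y v)"
  shows "D (\<alpha> (\<alpha> x)) (\<alpha> (\<alpha> y)) (D z s v) =
    D (tr x y z) (\<alpha> (\<alpha> s)) (\<beta> (\<beta> v)) + D (\<alpha> (\<alpha> z)) (tr x y s) (\<beta> (\<beta> v))
    + D (\<alpha> (\<alpha> z)) (\<alpha> (\<alpha> s)) (D x y v)"
proof -
  let ?D = "D (\<alpha> (\<alpha> x)) (\<alpha> (\<alpha> y))" and ?b = "\<beta> (\<beta> v)"
  \<comment> \<open>A Leibniz rule from two uses of \<open>R4\<close>, first for
    \<open>\<alpha> x\<close>, \<open>\<alpha> y\<close> and then for \<open>x\<close>,
    \<open>y\<close>: each \<rho> factor takes its turn in receiving the triple bracket.\<close>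
  have rho_rho: "?D (\<rho> (\<alpha> p) (\<rho> q v)) =
      \<rho> (\<alpha> (\<alpha> (\<alpha> p))) (\<rho> (\<alpha> (\<alpha> q)) (D x y v)) + \<rho> (\<alpha> (\<alpha> (\<alpha> p))) (\<rho> (tr x y q) ?b)
      + \<rho> (\<alpha> (tr x y p)) (\<rho> (\<alpha> (\<alpha> q)) ?b)"
    if "\<alpha> (tr x y p) = tr (\<alpha> x) (\<alpha> y) (\<alpha> p)" for p q
    using that by (simp add: R4 rho_linear_simps R1_rho)
  \<comment> \<open>\<open>R4\<close> produces the triple bracket of \<open>\<alpha> x\<close>,
    \<open>\<alpha> y\<close> and \<open>br z s\<close>, which \<open>hly4\<close> splits into the
    last two terms.\<close>
  have rho_br: "?D (\<rho> (br z s) (\<beta> v)) =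
      \<rho> (br (\<alpha> (\<alpha> z)) (\<alpha> (\<alpha> s))) (\<beta> (D x y v)) + \<rho> (br (tr x y z) (\<alpha> (\<alpha> s))) (\<beta> ?b)
      + \<rho> (br (\<alpha> (\<alpha> z)) (tr x y s)) (\<beta> ?b)"
    by (simp add: R4 alpha_br D_beta hly4 rho_linear_simps)
  have "?D (D z s v) = ?D (\<theta> s z v) - ?D (\<theta> z s v) + ?D (\<rho> (\<alpha> z) (\<rho> s v))
      - ?D (\<rho> (\<alpha> s) (\<rho> z v)) - ?D (\<rho> (br z s) (\<beta> v))"
    by (simp add: rep_D_def[of br \<alpha> \<rho> \<theta> \<beta> z s] D_linear_simps)
  also have "\<dots> = D (tr x y z) (\<alpha> (\<alpha> s)) ?b + D (\<alpha> (\<alpha> z)) (tr x y s) ?b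
      + D (\<alpha> (\<alpha> z)) (\<alpha> (\<alpha> s)) (D x y v)"
    by (simp only: rho_rho[OF alpha_tr(1)] rho_rho[OF alpha_tr(2)] rho_br R6
        rep_D_def[of br \<alpha> \<rho> \<theta> \<beta> "tr x y z"] rep_D_def[of br \<alpha> \<rho> \<theta> \<beta> "\<alpha> (\<alpha> z)"])
      (simp add: algebra_simps)
  finally show ?thesis .
qed

end

context hly_cocycle
begin

lemmas F_linear_simps =
  linear_map_add[OF F_bilinear[unfolded bilinear_map_def, THEN conjunct1, rule_format]]
  linear_map_add[OF F_bilinear[unfolded bilinear_map_def, THEN conjunct2, rule_format]]
  linear_map_scale[OF F_bilinear[unfolded bilinear_map_def, THEN conjunct1, rule_format]]
  linear_map_scale[OF F_bilinear[unfolded bilinear_map_def, THEN conjunct2, rule_format]]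

lemmas G_linear_simps =
  linear_map_add[OF G_trilinear[unfolded trilinear_map_def, THEN conjunct1, rule_format]]
  linear_map_add[OF G_trilinear[unfolded trilinear_map_def, THEN conjunct2, THEN conjunct1, rule_format]]
  linear_map_add[OF G_trilinear[unfolded trilinear_map_def, THEN conjunct2, THEN conjunct2, rule_format]]
  linear_map_scale[OF G_trilinear[unfolded trilinear_map_def, THEN conjunct1, rule_format]]
  linear_map_scale[OF G_trilinear[unfolded trilinear_map_def, THEN conjunct2, THEN conjunct1, rule_format]]
  linear_map_scale[OF G_trilinear[unfolded trilinear_map_def, THEN conjunct2, THEN conjunct2, rule_format]]

end

context twisted_O_operator
begin

abbreviation brT where "brT \<equiv> T_bracket \<rho> F T"
abbreviation trT where "trT \<equiv> T_triple br \<alpha> \<rho> \<theta> \<beta> G T"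

lemmas T_linear_simps = linear_map_add[OF T_linear] linear_map_scale[OF T_linear]

text \<open>This and \<open>T_trT\<close> are the morphism property of \<open>T\<close>; below they
  serve as rewrite rules that push \<open>T\<close> through an inner bracket.\<close>

lemma T_brT: "T (brT u v) = br (T u) (T v)"
  by (simp add: T_bracket_def T_br)

lemma T_trT: "T (trT u v w) = tr (T u) (T v) (T w)"
  by (simp add: T_triple_def T_tr)

lemma beta_brT: "\<beta> (brT u v) = brT (\<beta> u) (\<beta> v)"
  by (simp add: T_bracket_def T_beta R1_rho F_equivariant beta_linear_simps)

lemma alpha_br_T: "\<alpha> (br (T u) (T v)) = br (\<alpha> (T u)) (\<alpha> (T v))"
  by (metis T_brT T_beta beta_brT)

text \<open>The summand of \<open>D\<close> containing \<open>br\<close> forces the restriction to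
  the image of \<open>T\<close>: equivariance there needs \<open>alpha_br_T\<close>. The result in
  turn gives \<open>beta_trT\<close> and hence \<open>alpha_tr_T\<close>.\<close>

lemma D_beta_T: "D (\<alpha> (T u)) (\<alpha> (T v)) (\<beta> w) = \<beta> (D (T u) (T v) w)"
  by (simp add: rep_D_def beta_linear_simps R1_theta R1_rho[symmetric] alpha_br_T)

lemma beta_trT: "\<beta> (trT u v w) = trT (\<beta> u) (\<beta> v) (\<beta> w)"
  by (simp add: T_triple_def T_beta R1_theta D_beta_T G_equivariant beta_linear_simps)

lemma alpha_tr_T: "\<alpha> (tr (T u) (T v) (T w)) = tr (\<alpha> (T u)) (\<alpha> (T v)) (\<alpha> (T w))"
  by (metis T_trT T_beta beta_trT)

lemma D_derivation_T:
  "D (\<alpha> (\<alpha> (T u))) (\<alpha> (\<alpha> (T v))) (D (T w) (T t) r) =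
    D (tr (T u) (T v) (T w)) (\<alpha> (\<alpha> (T t))) (\<beta> (\<beta> r))
    + D (\<alpha> (\<alpha> (T w))) (tr (T u) (T v) (T t)) (\<beta> (\<beta> r))
    + D (\<alpha> (\<alpha> (T w))) (\<alpha> (\<alpha> (T t))) (D (T u) (T v) r)"
  \<comment> \<open>\<open>alpha_br_T\<close> can be iterated since
    \<open>\<alpha> (T u) = T (\<beta> u)\<close> stays in the image of \<open>T\<close>.\<close>
  by (rule D_derivation) (metis alpha_br_T T_beta, simp_all add: alpha_tr_T D_beta_T)

lemma bilinear_brT: "bilinear_map sV sV sV brT"
  by (simp add: bilinear_map_def Vector_Spaces.linear_iff vector_space_V T_bracket_def
      T_linear_simps rho_linear_simps F_linear_simps V_scale_simps)

lemma trilinear_trT: "trilinear_map sV sV sV sV trT"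
  by (simp add: trilinear_map_def Vector_Spaces.linear_iff vector_space_V T_triple_def
      T_linear_simps D_linear_simps theta_linear_simps G_linear_simps V_scale_simps)

text \<open>The \<rho> and \<theta> terms cancel in the cyclic sum by the very definition of
  \<open>D\<close>; \<open>C1\<close> removes the terms in \<open>F\<close> and
  \<open>G\<close>.\<close>

lemma hly2_T:
  "cyclic_sum (\<lambda>u v w. brT (brT u v) (\<beta> w)) u v w + cyclic_sum trT u v w = 0"
proof -
  \<comment> \<open>\<open>C1\<close> is solved for one summand at fixed arguments, so that it
    rewrites without looping. The same is done with \<open>R2\<close>, \<open>C2\<close>,
    \<open>C3\<close> and \<open>C4\<close> below.\<close>
  have C1': "F (br (T u) (T v)) (\<alpha> (T w)) =
      - (F (br (T v) (T w)) (\<alpha> (T u)) + F (br (T w) (T u)) (\<alpha> (T v)))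
      + \<rho> (\<alpha> (T u)) (F (T v) (T w)) + \<rho> (\<alpha> (T v)) (F (T w) (T u)) + \<rho> (\<alpha> (T w)) (F (T u) (T v))
      - (G (T u) (T v) (T w) + G (T v) (T w) (T u) + G (T w) (T u) (T v))"
    by (rule iffD2[OF eq_iff_diff_eq_0 trans[OF _ C1[of "T u" "T v" "T w"]]])
      (simp add: cyclic_sum_def)
  show ?thesis
    \<comment> \<open>Only outer brackets are unfolded at first, so that \<open>T\<close> of an
      inner bracket can become \<open>br\<close>; the inner ones are expanded afterwards.\<close>
    by (simp add: cyclic_sum_def T_bracket_def[of \<rho> F T "brT _ _"] T_brT T_beta C1')
      (simp add: T_bracket_def T_triple_def rep_D_def rho_linear_simps algebra_simps)
qed

text \<open>\<open>R2\<close> cancels the terms in \<open>t\<close>, \<open>R3\<close> turns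
  \<theta> of a bracket into terms matching the \<rho> part of the inner brackets, and
  \<open>C2\<close> settles \<open>F\<close> and \<open>G\<close>.\<close>

lemma hly3_T: "cyclic_sum (\<lambda>u v w. trT (brT u v) (\<beta> w) (\<beta> t)) u v w = 0"
proof -
  have R2': "D (br (T u) (T v)) (\<alpha> (T w)) (\<beta> t) =
      - (D (br (T v) (T w)) (\<alpha> (T u)) (\<beta> t) + D (br (T w) (T u)) (\<alpha> (T v)) (\<beta> t))"
    by (rule iffD2[OF eq_iff_diff_eq_0 trans[OF _ R2[of "T u" "T v" "T w" "\<beta> t"]]]) simp
  have C2': "G (br (T u) (T v)) (\<alpha> (T w)) (\<alpha> (T t)) =
      - (G (br (T v) (T w)) (\<alpha> (T u)) (\<alpha> (T t)) + G (br (T w) (T u)) (\<alpha> (T v)) (\<alpha> (T t)))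
      - (\<theta> (\<alpha> (T u)) (\<alpha> (T t)) (F (T v) (T w)) + \<theta> (\<alpha> (T v)) (\<alpha> (T t)) (F (T w) (T u))
         + \<theta> (\<alpha> (T w)) (\<alpha> (T t)) (F (T u) (T v)))"
    by (rule iffD2[OF eq_iff_diff_eq_0 trans[OF _ C2[of "T t" "T u" "T v" "T w"]]])
      (simp add: cyclic_sum_def)
  show ?thesis
    by (simp add: cyclic_sum_def T_triple_def T_brT T_beta R2' C2' R3)
      (simp add: T_bracket_def theta_linear_simps)
qed

text \<open>\<open>R5\<close> accounts for the coefficients of \<open>u\<close> and
  \<open>v\<close>, \<open>R4\<close> for those of \<open>w\<close> and \<open>t\<close>, and
  \<open>C3\<close> for the cocycle terms.\<close>

lemma hly4_T:
  "trT (\<beta> u) (\<beta> v) (brT w t) = brT (trT u v w) (\<beta> (\<beta> t)) + brT (\<beta> (\<beta> w)) (trT u v t)"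
proof -
  have C3': "G (\<alpha> (T u)) (\<alpha> (T v)) (br (T w) (T t)) =
      - D (\<alpha> (T u)) (\<alpha> (T v)) (F (T w) (T t)) - \<rho> (\<alpha> (\<alpha> (T t))) (G (T u) (T v) (T w))
      + F (tr (T u) (T v) (T w)) (\<alpha> (\<alpha> (T t))) + \<rho> (\<alpha> (\<alpha> (T w))) (G (T u) (T v) (T t))
      + F (\<alpha> (\<alpha> (T w))) (tr (T u) (T v) (T t))"
    by (rule iffD2[OF eq_iff_diff_eq_0 trans[OF _ C3[of "T u" "T v" "T w" "T t"]]]) simp
  show ?thesis
    by (simp add: T_triple_def[of _ _ _ _ _ _ _ "\<beta> _"] T_bracket_def[of _ _ _ "trT _ _ _"]
        T_bracket_def[of _ _ _ "\<beta> _"] T_brT T_trT T_beta C3' R5)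
      (simp add: T_bracket_def T_triple_def D_linear_simps rho_linear_simps R4)
qed

text \<open>Coefficients of \<open>u\<close> and \<open>v\<close> match by \<open>R7\<close>, of
  \<open>w\<close> and \<open>t\<close> by \<open>R6\<close>, of \<open>r\<close> by
  \<open>D_derivation_T\<close>; \<open>C4\<close> matches the cocycle terms.\<close>

lemma hly5_T:
  "trT (\<beta> (\<beta> u)) (\<beta> (\<beta> v)) (trT w t r) =
    trT (trT u v w) (\<beta> (\<beta> t)) (\<beta> (\<beta> r)) + trT (\<beta> (\<beta> w)) (trT u v t) (\<beta> (\<beta> r))
    + trT (\<beta> (\<beta> w)) (\<beta> (\<beta> t)) (trT u v r)"
proof -
  have C4': "G (\<alpha> (\<alpha> (T u))) (\<alpha> (\<alpha> (T v))) (tr (T w) (T t) (T r)) =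
      \<theta> (\<alpha> (\<alpha> (T t))) (\<alpha> (\<alpha> (T r))) (G (T u) (T v) (T w))
      - \<theta> (\<alpha> (\<alpha> (T w))) (\<alpha> (\<alpha> (T r))) (G (T u) (T v) (T t))
      - D (\<alpha> (\<alpha> (T u))) (\<alpha> (\<alpha> (T v))) (G (T w) (T t) (T r))
      + D (\<alpha> (\<alpha> (T w))) (\<alpha> (\<alpha> (T t))) (G (T u) (T v) (T r))
      + G (tr (T u) (T v) (T w)) (\<alpha> (\<alpha> (T t))) (\<alpha> (\<alpha> (T r)))
      + G (\<alpha> (\<alpha> (T w))) (tr (T u) (T v) (T t)) (\<alpha> (\<alpha> (T r)))
      + G (\<alpha> (\<alpha> (T w))) (\<alpha> (\<alpha> (T t))) (tr (T u) (T v) (T r))"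
    by (rule iffD2[OF eq_iff_diff_eq_0 trans[OF _ C4[of "T t" "T r" "T u" "T v" "T w"]]]) simp
  show ?thesis
    \<comment> \<open>\<open>R7\<close> is instantiated because it must not touch \<theta> terms
      such as \<open>\<theta> (\<alpha> (\<alpha> (T w))) (tr (T u) (T v) (T r))\<close> on the
      right, which have to meet the output of \<open>R6\<close>. Likewise \<open>R6\<close> must act
      only under the outer operator for \<open>T u\<close> and \<open>T v\<close>.\<close>
    by (simp add: T_triple_def[of _ _ _ _ _ _ _ "\<beta> _"] T_triple_def[of _ _ _ _ _ _ _ "trT _ _ _"]
        T_trT T_beta C4' R7[of "T u"] R7[of "T v"])
      (simp add: T_triple_def D_linear_simps theta_linear_simps R6[of "T u" "T v"]
        D_derivation_T[of u v])
qed

lemma hom_lie_yamaguti_algebra_T: "hom_lie_yamaguti_algebra sV brT trT \<beta>"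
proof (rule hom_lie_yamaguti_algebra.intro)
  fix u v w
  show "brT u v = - brT v u"
    using F_skew[of "T u" "T v"] by (simp add: T_bracket_def)
  show "trT u v w = - trT v u w"
    using G_skew[of "T u" "T v"] D_skew[of "T u" "T v" w] by (simp add: T_triple_def)
qed (fact fin_dim_V linear_beta bilinear_brT trilinear_trT hly2_T hly3_T hly4_T hly5_T)+

end

theorem proposition3p14:
  fixes sA :: "'k::field_char_0 \<Rightarrow> 'a::ab_group_add \<Rightarrow> 'a"
    and br :: "'a \<Rightarrow> 'a \<Rightarrow> 'a" and tr :: "'a \<Rightarrow> 'a \<Rightarrow> 'a \<Rightarrow> 'a" and \<alpha> :: "'a \<Rightarrow> 'a"
    and sV :: "'k \<Rightarrow> 'v::ab_group_add \<Rightarrow> 'v"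
    and \<rho> :: "'a \<Rightarrow> 'v \<Rightarrow> 'v" and \<theta> :: "'a \<Rightarrow> 'a \<Rightarrow> 'v \<Rightarrow> 'v" and \<beta> :: "'v \<Rightarrow> 'v"
    and F :: "'a \<Rightarrow> 'a \<Rightarrow> 'v" and G :: "'a \<Rightarrow> 'a \<Rightarrow> 'a \<Rightarrow> 'v" and T :: "'v \<Rightarrow> 'a"
  assumes "hom_lie_yamaguti_algebra sA br tr \<alpha>"
    and "hly_representation sA br tr \<alpha> sV \<rho> \<theta> \<beta>"
    and "hly_cocycle sA br tr \<alpha> sV \<rho> \<theta> \<beta> F G"
    and "twisted_O_operator sA br tr \<alpha> sV \<rho> \<theta> \<beta> F G T"
  shows "hom_lie_yamaguti_algebra sV (T_bracket \<rho> F T) (T_triple br \<alpha> \<rho> \<theta> \<beta> G T) \<beta>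
    \<and> hly_morphism sV (T_bracket \<rho> F T) (T_triple br \<alpha> \<rho> \<theta> \<beta> G T) \<beta> sA br tr \<alpha> T"
proof -
  interpret twisted_O_operator sA br tr \<alpha> sV \<rho> \<theta> \<beta> F G T by fact
  interpret V: hom_lie_yamaguti_algebra sV brT trT \<beta> by (fact hom_lie_yamaguti_algebra_T)
  have "hly_morphism sV brT trT \<beta> sA br tr \<alpha> T"
    by (intro hly_morphism.intro hly_morphism_axioms.intro)
      (fact V.hom_lie_yamaguti_algebra_axioms hom_lie_yamaguti_algebra_axioms T_linear T_brT T_trT)+
  then show ?thesis using V.hom_lie_yamaguti_algebra_axioms by blast
qed

end
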